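(* Let $a\in\mathbb{C}\setminus\{0,-1,-2,\ldots\}$. In a neighborhood of $s=0$ we have $$\zeta_H(s,a)=\frac{1}{2s}+\gamma_{H,0}(0,a)+O(s),\qquad\text{where}\qquad \gamma_{H,0}(0,a)=-\zeta(0,a)-\frac12\psi(a).$$
   Context: $H_n(a)=\sum_{k=0}^n\frac1{k+a}$ and $\zeta_H(s,a)=\sum_{n=0}^\infty\frac{H_n(a)}{(n+a)^s}$ for $\operatorname{Re}(s)>1$; the same symbol denotes its meromorphic continuation to the complex $s$-plane. $\zeta(s,a)$ is the (analytically continued) Hurwitz zeta function $\sum_{n=0}^\infty(n+a)^{-s}$ and $\psi=\Gamma'/\Gamma$. *)

theory Defs
  imports "HOL-Complex_Analysis.Complex_Analysis" "HOL-Library.Landau_Symbols"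
begin

text \<open>
  The meromorphic continuation to the whole plane of a function given on \<open>S\<close>. Requiring
  \<^const>\<open>nicely_meromorphic_on\<close> (value 0 at poles, no removable singularities) makes
  it unique as soon as \<open>S\<close> is open and nonempty, see \<open>mero_continuation_eqI\<close> below.
\<close>

definition mero_continuation :: "complex set \<Rightarrow> (complex \<Rightarrow> complex) \<Rightarrow> complex \<Rightarrow> complex" where
  "mero_continuation S f =
     (THE F. F nicely_meromorphic_on UNIV \<and> (\<forall>s\<in>S. F s = f s))"

lemma nicely_meromorphic_unique:
  assumes F: "F nicely_meromorphic_on UNIV" and G: "G nicely_meromorphic_on UNIV"
    and S: "open S" "S \<noteq> {}" and eq: "\<And>s. s \<in> S \<Longrightarrow> F s = G s"
  shows "F = G"
proof
  fix z
  define D where "D = (\<lambda>s. F s - G s)"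
  have D: "D meromorphic_on UNIV"
    using F G unfolding D_def nicely_meromorphic_on_def by (auto intro!: meromorphic_intros)
  have "(\<forall>\<^sub>\<approx>x\<in>UNIV. D x = 0) \<or> (\<forall>\<^sub>\<approx>x\<in>UNIV. D x \<noteq> 0)"
    by (rule meromorphic_imp_constant_or_avoid[OF D]) auto
  moreover have "\<not> (\<forall>\<^sub>\<approx>x\<in>UNIV. D x \<noteq> 0)"
  proof
    assume *: "\<forall>\<^sub>\<approx>x\<in>UNIV. D x \<noteq> 0"
    from S obtain w where w: "w \<in> S" by auto
    from * have "\<forall>\<^sub>F x in at w. D x \<noteq> 0"
      by (simp add: eventually_cosparse_open_eq)
    moreover have "\<forall>\<^sub>F x in at w. x \<in> S"
      using S(1) w by (rule eventually_at_in_open')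
    ultimately have "\<forall>\<^sub>F x in at w. False"
      by eventually_elim (auto simp: D_def eq)
    thus False by simp
  qed
  ultimately have "\<forall>\<^sub>F x in at z. D x = 0"
    by (simp add: eventually_cosparse_open_eq)
  hence ev: "\<forall>\<^sub>F x in at z. F x = G x"
    by (simp add: D_def)
  have pole: "is_pole F z \<longleftrightarrow> is_pole G z"
    by (rule is_pole_cong[OF ev refl])
  have lim: "F \<midarrow>z\<rightarrow> c \<longleftrightarrow> G \<midarrow>z\<rightarrow> c" for c
    by (rule filterlim_cong[OF refl refl ev])
  show "F z = G z"
  proof (cases "is_pole F z")
    case True
    thus ?thesis
      using is_pole_zero_at_nicely_mero[OF F] is_pole_zero_at_nicely_mero[OF G] pole by auto
  next
    case False
    hence "F \<midarrow>z\<rightarrow> F z" "G \<midarrow>z\<rightarrow> G z"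
      using F G pole by (auto simp: nicely_meromorphic_on_def)
    thus ?thesis
      using lim LIM_unique by blast
  qed
qed

lemma mero_continuation_eqI:
  assumes "open S" "S \<noteq> {}" "F nicely_meromorphic_on UNIV" "\<And>s. s \<in> S \<Longrightarrow> F s = f s"
  shows "mero_continuation S f = F"
  unfolding mero_continuation_def
proof (rule the_equality)
  fix G assume G: "G nicely_meromorphic_on UNIV \<and> (\<forall>s\<in>S. G s = f s)"
  show "G = F"
    by (rule nicely_meromorphic_unique[of G F S]) (use assms G in auto)
qed (use assms in auto)

text \<open>
  Complex powers use the principal branch of the logarithm; this matters only for the
  finitely many \<open>n\<close> for which \<open>n + a\<close> is not in the right half-plane.
\<close>

definition hurwitz_zeta :: "complex \<Rightarrow> complex \<Rightarrow> complex" where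
  "hurwitz_zeta s a =
     mero_continuation {s. Re s > 1} (\<lambda>s. \<Sum>n. (of_nat n + a) powr (- s)) s"

definition H :: "nat \<Rightarrow> complex \<Rightarrow> complex" where
  "H n a = (\<Sum>k\<le>n. 1 / (of_nat k + a))"

definition zeta_H :: "complex \<Rightarrow> complex \<Rightarrow> complex" where
  "zeta_H s a =
     mero_continuation {s. Re s > 1} (\<lambda>s. \<Sum>n. H n a / (of_nat n + a) powr s) s"

text \<open>The constant term of the Laurent expansion of \<open>\<lambda>s. zeta_H s a\<close> about \<open>s = s0\<close>.\<close>

definition gamma_H0 :: "complex \<Rightarrow> complex \<Rightarrow> complex" where
  "gamma_H0 s0 a = fls_nth (laurent_expansion (\<lambda>s. zeta_H s a) s0) 0"

text \<open>The library's \<^term>\<open>Digamma\<close> is the logarithmic derivative of \<^term>\<open>Gamma\<close>.\<close>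

lemma Digamma_eq_deriv_Gamma:
  fixes a :: complex
  assumes "a \<notin> \<int>\<^sub>\<le>\<^sub>0"
  shows "Digamma a = deriv Gamma a / Gamma a"
  using DERIV_imp_deriv[OF has_field_derivative_Gamma[OF assms]] assms
  by (simp add: Gamma_eq_zero_iff)

end

theory Submission
  imports Defs "HOL-Real_Asymp.Real_Asymp"
begin

text \<open>
  For \<open>D(s) = \<Sum>n. c n / (n + a)\<^sup>s\<close>, expand \<open>(n + a + 1) powr (1 - s)\<close> around \<open>n + a\<close> to order \<open>K\<close> in
  \<open>\<Sum>n. c n * ((n + a) powr (1 - s) - (n + a + 1) powr (1 - s)) = E(s)\<close>. This gives
  \<open>(s - 1) D(s) = E(s) + (\<Sum>k=2..K. binom(1 - s, k) D(s + k - 1)) + R\<^sub>K(s)\<close> with \<open>R\<^sub>K\<close> holomorphic for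
  \<open>Re s > 1 - K\<close>. By Abel summation \<open>E(s)\<close> is \<open>a powr (1 - s)\<close> for the coefficients 1, and it is
  \<open>\<zeta>(s,a)\<close> for the coefficients \<open>H\<^sub>n(a)\<close>, so the recursion continues both functions strip by strip.

  Since \<open>R\<^sub>1(1) = 0\<close>, the case \<open>K = 1\<close> at \<open>s = 1\<close> gives \<open>(s - 1) \<zeta>(s,a) = 1 - \<psi>(a) (s - 1) + \<dots>\<close> and hence
  \<open>(s - 1)\<^sup>2 \<zeta>\<^sub>H(s,a) = 1 - \<psi>(a) (s - 1) + \<dots>\<close>. Since \<open>R\<^sub>2(0) = 0\<close>, the case \<open>K = 2\<close> at \<open>s = 0\<close> reads
  \<open>\<zeta>\<^sub>H(s,a) = - \<zeta>(s,a) + (s / 2) \<zeta>\<^sub>H(s + 1,a) + o(1)\<close>, whose middle term is \<open>1 / (2 s) - \<psi>(a) / 2 + o(1)\<close>.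
\<close>

section \<open>Binomial remainders and termwise differentiation\<close>

definition binom_rem :: "nat \<Rightarrow> complex \<Rightarrow> complex \<Rightarrow> complex" where
  "binom_rem K z w = (z + 1) powr w - (\<Sum>k\<le>K. (w gchoose k) * z powr (w - of_nat k))"

text \<open>Each factor |w - j| / (j + 1) is at most (M + j + 1) / (j + 1), and the product of these
  bounds over j < k is \<open>(M + k) choose k\<close>. The estimate is uniform on a disc in w, as
  locally uniform convergence requires.\<close>

lemma norm_gbinomial_le:
  fixes w :: complex
  assumes "norm w \<le> real M"
  shows "norm (w gchoose k) \<le> 2 ^ (M + k)"
proof -
  have "norm (w gchoose k) \<le> real ((M + k) choose k)"
  proof (induction k)
    case (Suc k)
    have rec: "w gchoose Suc k = (w gchoose k) * ((w - of_nat k) / of_nat (Suc k))"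
      using gbinomial_mult_1[of w k] by (simp add: field_simps del: of_nat_Suc)
    have "norm (w - of_nat k) \<le> real (M + Suc k)"
      using norm_triangle_ineq4[of w "of_nat k"] assms by simp
    hence "norm (w gchoose Suc k) \<le> real ((M + k) choose k) * (real (M + Suc k) / real (Suc k))"
      unfolding rec norm_mult norm_divide norm_of_nat
      by (intro mult_mono divide_right_mono Suc.IH) auto
    also have "\<dots> = real ((M + Suc k) choose Suc k)"
    proof -
      have "Suc k * (Suc (M + k) choose Suc k) = Suc (M + k) * ((M + k) choose k)"
        using Suc_times_binomial_eq[of "M + k" k] by (simp only: mult.commute)
      hence "real (Suc k) * real (Suc (M + k) choose Suc k) = real (Suc (M + k)) * real ((M + k) choose k)"
        by (metis of_nat_mult)
      thus ?thesis by (simp add: field_simps)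
    qed
    finally show ?case .
  qed auto
  also have "\<dots> \<le> real (2 ^ (M + k))"
    by (rule of_nat_mono, rule binomial_le_pow2)
  finally show ?thesis by simp
qed

text \<open>The coefficient bound grows like 2^k, so |x| \<le> 1/4 leaves a geometric ratio of at
  most 1/2. The tail is then at most twice the bound for its first term, whence the exponent M + K +
  2.\<close>

lemma norm_binomial_tail_le:
  fixes w x :: complex
  assumes w: "norm w \<le> real M" and x: "norm x \<le> 1 / 4"
  shows "norm ((1 + x) powr w - (\<Sum>k\<le>K. (w gchoose k) * x ^ k)) \<le> 2 ^ (M + K + 2) * norm x ^ Suc K"
proof -
  let ?f = "\<lambda>k. (w gchoose k) * x ^ k"
  have "?f sums ((1 + x) powr w)"
    by (rule gen_binomial_complex) (use x in simp)
  hence "(\<lambda>k. ?f (k + Suc K)) sums ((1 + x) powr w - (\<Sum>k<Suc K. ?f k))"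
    by (subst sums_iff_shift) simp
  hence s: "(\<lambda>k. ?f (k + Suc K)) sums ((1 + x) powr w - (\<Sum>k\<le>K. ?f k))"
    by (simp add: lessThan_Suc_atMost)
  let ?c = "2 ^ (M + Suc K) * norm x ^ Suc K :: real"
  have le: "norm (?f (k + Suc K)) \<le> ?c * (1 / 2) ^ k" for k
  proof -
    have "norm (?f (k + Suc K)) \<le> 2 ^ (M + (k + Suc K)) * norm x ^ (k + Suc K)"
      by (simp only: norm_mult norm_power) (intro mult_right_mono norm_gbinomial_le w, simp)
    also have "\<dots> = ?c * (2 * norm x) ^ k"
      by (simp add: power_add power_mult_distrib mult_ac)
    also have "\<dots> \<le> ?c * (1 / 2) ^ k"
      by (intro mult_left_mono power_mono) (use x in auto)
    finally show ?thesis .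
  qed
  have g: "(\<lambda>k. ?c * (1 / 2) ^ k) sums (?c * 2)"
    using sums_mult[OF geometric_sums[of "1/2::real"], of ?c] by simp
  have "norm ((1 + x) powr w - (\<Sum>k\<le>K. ?f k)) \<le> ?c * 2"
    using norm_suminf_le[OF le sums_summable[OF g]] sums_unique[OF s] sums_unique[OF g] by simp
  thus ?thesis by (simp add: mult_ac)
qed

text \<open>The modulus is |z|^(Re w) exp(- Im w Arg z) with |Arg z| \<le> pi, so the choice of
  branch costs only a constant factor, uniform in z.\<close>

lemma norm_powr_le_cball:
  fixes z w :: complex
  assumes "norm w \<le> M"
  shows "norm (z powr w) \<le> exp (pi * M) * norm z powr Re w"
proof -
  have "- Im w * Arg z \<le> \<bar>Im w\<bar> * \<bar>Arg z\<bar>"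
    by (metis abs_ge_self abs_minus_cancel abs_mult)
  also have "\<dots> \<le> M * pi"
    using assms abs_Im_le_cmod[of w] Arg_bounded[of z] by (intro mult_mono) auto
  finally have "exp (- Im w * Arg z) \<le> exp (pi * M)"
    by (simp add: mult.commute)
  thus ?thesis
    unfolding norm_powr_complex by (subst mult.commute) (rule mult_right_mono, auto)
qed

text \<open>Both z and 1 + 1/z lie in the right half-plane, so their arguments add up to less than
  pi in absolute value and the principal logarithms add.\<close>

lemma powr_add_one_factor:
  fixes z w :: complex
  assumes "Re z > 0"
  shows "(z + 1) powr w = z powr w * (1 + 1 / z) powr w"
proof -
  have z: "z \<noteq> 0" using assms by auto
  have "Re (1 / z) > 0"
    using assms z by (simp add: Re_divide power2_eq_square sum_squares_gt_zero_iff)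
  hence pos: "Re (1 + 1 / z) > 0" by simp
  hence nz: "1 + 1 / z \<noteq> 0" by (metis less_irrefl zero_complex.sel(1))
  have "\<bar>Im (Ln z)\<bar> < pi / 2" "\<bar>Im (Ln (1 + 1 / z))\<bar> < pi / 2"
    using assms pos z nz Re_Ln_pos_lt by blast+
  hence "Ln (z * (1 + 1 / z)) = Ln z + Ln (1 + 1 / z)"
    using z nz by (intro Ln_times_simple) auto
  moreover have "z * (1 + 1 / z) = z + 1" using z by (simp add: field_simps)
  moreover have "Re (z + 1) > 0" using assms by simp
  hence "z + 1 \<noteq> 0" by (metis less_irrefl zero_complex.sel(1))
  ultimately show ?thesis
    using z nz by (simp add: powr_def exp_add ring_distribs)
qed

text \<open>With z powr w factored out, this is the binomial tail at x = 1/z. The K + 1 powers of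
  1/z gained for w = 1 - s are what widen the half-plane of convergence to Re s > 1 - K.\<close>

lemma norm_binom_rem_le:
  assumes z: "Re z \<ge> 4" and w: "norm w \<le> real M"
  shows "norm (binom_rem K z w) \<le>
           exp (pi * real M) * 2 ^ (M + K + 2) * norm z powr (Re w - real (Suc K))"
proof -
  have z0: "z \<noteq> 0" using z by auto
  have z4: "norm z \<ge> 4" using z complex_Re_le_cmod[of z] by linarith
  have "(w gchoose k) * z powr (w - of_nat k) = z powr w * ((w gchoose k) * (1 / z) ^ k)" for k
    using z0 by (simp add: powr_diff powr_nat power_divide)
  moreover have "(z + 1) powr w = z powr w * (1 + 1 / z) powr w"
    using z by (intro powr_add_one_factor) simp
  ultimately have "binom_rem K z w =
          z powr w * ((1 + 1 / z) powr w - (\<Sum>k\<le>K. (w gchoose k) * (1 / z) ^ k))"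
    unfolding binom_rem_def by (simp only: sum_distrib_left right_diff_distrib)
  hence "norm (binom_rem K z w) = norm (z powr w) *
      norm ((1 + 1 / z) powr w - (\<Sum>k\<le>K. (w gchoose k) * (1 / z) ^ k))"
    by (simp only: norm_mult)
  also have "\<dots> \<le> (exp (pi * real M) * norm z powr Re w) * (2 ^ (M + K + 2) * norm (1 / z) ^ Suc K)"
  proof (rule mult_mono)
    show "norm (z powr w) \<le> exp (pi * real M) * norm z powr Re w"
      using w by (rule norm_powr_le_cball)
    show "norm ((1 + 1 / z) powr w - (\<Sum>k\<le>K. (w gchoose k) * (1 / z) ^ k))
            \<le> 2 ^ (M + K + 2) * norm (1 / z) ^ Suc K"
      using w by (rule norm_binomial_tail_le) (use frac_le[OF _ _ _ z4, of 1 1] in \<open>simp add: norm_divide\<close>)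
  qed auto
  also have "\<dots> = exp (pi * real M) * 2 ^ (M + K + 2) * norm z powr (Re w - real (Suc K))"
  proof -
    have "norm z powr real (Suc K) = norm z ^ Suc K"
      using z4 by (intro powr_realpow) auto
    hence "norm z powr (Re w - real (Suc K)) = norm z powr Re w / norm z ^ Suc K"
      by (simp only: powr_diff)
    thus ?thesis by (simp add: norm_divide power_divide)
  qed
  finally show ?thesis .
qed

text \<open>Growth below every positive power covers the constants and the logarithmic growth of
  \<open>H n a\<close> at once. The loss n^e is absorbed because the half-planes of convergence are
  open.\<close>

definition subpoly :: "(nat \<Rightarrow> complex) \<Rightarrow> bool" where
  "subpoly c \<longleftrightarrow> (\<forall>e>0. c \<in> O(\<lambda>n. of_real (real n powr e)))"

lemma eventually_norm_of_nat_add_ge: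
  fixes a :: complex
  shows "\<forall>\<^sub>F n in sequentially. Re (of_nat n + a) \<ge> B \<and> norm (of_nat n + a) \<ge> real n / 2"
proof -
  have "\<forall>\<^sub>F n in sequentially. n \<ge> nat \<lceil>max (B - Re a) (2 * norm a)\<rceil>"
    by (rule eventually_ge_at_top)
  thus ?thesis
  proof eventually_elim
    case (elim n)
    hence "real n \<ge> B - Re a" "real n \<ge> 2 * norm a" by linarith+
    thus ?case using norm_triangle_ineq2[of "of_nat n" "- a"] by simp
  qed
qed

text \<open>
  The threshold 4 makes the binomial series for \<open>(1 + 1 / (n + a)) powr w\<close> converge geometrically.
  It excludes only finitely many \<open>n\<close>, so \<open>a\<close> itself need not lie in the right half-plane.
\<close>

lemma series_comparison_halfplane:
  fixes a :: complex and q :: real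
  assumes c: "subpoly c"
    and der: "\<And>n s. (u n has_field_derivative u' n s) (at s)"
    and bound: "\<And>M::nat. \<exists>C. \<forall>n s. Re (of_nat n + a) \<ge> 4 \<longrightarrow> norm s \<le> real M \<longrightarrow>
                    norm (u n s) \<le> C * norm (of_nat n + a) powr (- Re s - q)"
    and s: "Re s > 1 - q"
  shows "summable (\<lambda>n. c n * u n s)"
    and "((\<lambda>s. \<Sum>n. c n * u n s) has_field_derivative (\<Sum>n. c n * u' n s)) (at s)"
    and "summable (\<lambda>n. c n * u' n s)"
proof -
  define S where "S = {s. Re s > 1 - q}"
  have S: "open S" unfolding S_def by (rule open_halfspace_Re_gt)
  have "\<exists>d h. 0 < d \<and> summable h \<and> range h \<subseteq> \<real>\<^sub>\<ge>\<^sub>0 \<and>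
     (\<forall>\<^sub>F n in sequentially. \<forall>y\<in>ball x d \<inter> S. norm (c n * u n y) \<le> norm (h n :: complex))"
    if x: "x \<in> S" for x
  proof -
    \<comment> \<open>A quarter of the distance from x to the boundary line: moving y inside the
      ball costs one e and the coefficients cost another, which leaves the summable exponent -1 - 2
      e.\<close>
    define e where "e = (Re x - 1 + q) / 4"
    have e: "e > 0" using x by (simp add: e_def S_def)
    define M where "M = nat \<lceil>norm x + e\<rceil>"
    obtain C where C: "\<And>n s. Re (of_nat n + a) \<ge> 4 \<Longrightarrow> norm s \<le> real M \<Longrightarrow>
                    norm (u n s) \<le> C * norm (of_nat n + a) powr (- Re s - q)"
      using bound[of M] by blast
    define C' where "C' = max C 0"
    obtain B where B: "B > 0" "\<forall>\<^sub>F n in sequentially. norm (c n) \<le> B * norm (of_real (real n powr e) :: complex)"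
      using c e unfolding subpoly_def by (blast elim: landau_o.bigE)
    define D where "D = B * C' * 2 powr (1 + 3 * e)"
    have D: "D \<ge> 0" using B by (auto simp: D_def C'_def)
    have "\<forall>\<^sub>F n in sequentially. \<forall>y\<in>ball x e \<inter> S.
            norm (c n * u n y) \<le> norm (of_real (D * real n powr (- 1 - 2 * e)) :: complex)"
      using B(2) eventually_norm_of_nat_add_ge[of 4 a] eventually_ge_at_top[of 2]
    proof eventually_elim
      case (elim n)
      show ?case
      proof
        fix y assume y: "y \<in> ball x e \<inter> S"
        have "norm (x - y) < e" using y by (simp add: dist_norm)
        hence ny: "norm y \<le> norm x + e" and Ry: "Re y \<ge> Re x - e"
          using norm_triangle_ineq2[of y x] complex_Re_le_cmod[of "x - y"]
          by (auto simp: norm_minus_commute)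
        have "norm y \<le> real M" using ny unfolding M_def by linarith
        hence "norm (u n y) \<le> C * norm (of_nat n + a) powr (- Re y - q)"
          using elim by (intro C) auto
        also have "\<dots> \<le> C' * norm (of_nat n + a) powr (- 1 - 3 * e)"
          using elim Ry unfolding C'_def
          by (intro mult_mono powr_mono) (auto simp: e_def field_simps)
        also have "\<dots> \<le> C' * (real n / 2) powr (- 1 - 3 * e)"
          using elim e unfolding C'_def by (intro mult_left_mono powr_mono2') auto
        also have "\<dots> = C' * 2 powr (1 + 3 * e) * real n powr (- 1 - 3 * e)"
          using powr_minus_divide[of 2 "1 + 3 * e"] by (simp add: powr_divide)
        finally have "norm (c n * u n y) \<le> (B * real n powr e) *
             (C' * 2 powr (1 + 3 * e) * real n powr (- 1 - 3 * e))"
          unfolding norm_mult using elim(1) B(1)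
          by (intro mult_mono) (auto simp: C'_def)
        also have "\<dots> = D * real n powr (e + (- 1 - 3 * e))"
          unfolding D_def powr_add by (simp add: mult_ac)
        also have "e + (- 1 - 3 * e) = - 1 - 2 * e" by simp
        finally show "norm (c n * u n y) \<le> norm (of_real (D * real n powr (- 1 - 2 * e)) :: complex)"
          using D by (simp add: norm_mult)
      qed
    qed
    moreover have "summable (\<lambda>n. of_real (D * real n powr (- 1 - 2 * e)) :: complex)"
      using e by (intro summable_of_real summable_mult) (simp add: summable_real_powr_iff)
    moreover have "range (\<lambda>n. of_real (D * real n powr (- 1 - 2 * e)) :: complex) \<subseteq> \<real>\<^sub>\<ge>\<^sub>0"
      using D by (auto simp del: of_real_mult)
    ultimately show ?thesis using e by blast
  qed
  moreover have "((\<lambda>s. c n * u n s) has_field_derivative c n * u' n x) (at x)" for n x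
    by (rule DERIV_cmult) (rule der)
  ultimately have "\<exists>g g'. \<forall>x\<in>S. (\<lambda>n. c n * u n x) sums g x \<and>
      (\<lambda>n. c n * u' n x) sums g' x \<and> (g has_field_derivative g' x) (at x)"
    by (rule series_and_derivative_comparison_complex[OF S, rotated -1])
  then obtain g g' where g: "\<And>x. x \<in> S \<Longrightarrow> (\<lambda>n. c n * u n x) sums g x"
      "\<And>x. x \<in> S \<Longrightarrow> (\<lambda>n. c n * u' n x) sums g' x"
      "\<And>x. x \<in> S \<Longrightarrow> (g has_field_derivative g' x) (at x)"
    by blast
  have sS: "s \<in> S" using s by (simp add: S_def)
  show "summable (\<lambda>n. c n * u n s)" "summable (\<lambda>n. c n * u' n s)"
    using g(1,2)[OF sS] by (auto simp: sums_iff)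
  have "((\<lambda>s. \<Sum>n. c n * u n s) has_field_derivative g' s) (at s)"
    by (rule has_field_derivative_transform_within_open[OF g(3)[OF sS] S sS])
      (use g(1) in \<open>auto simp: sums_iff\<close>)
  thus "((\<lambda>s. \<Sum>n. c n * u n s) has_field_derivative (\<Sum>n. c n * u' n s)) (at s)"
    using g(2)[OF sS] by (simp add: sums_iff)
qed

section \<open>Recursion for Dirichlet series with slowly growing coefficients\<close>

definition dirichlet :: "(nat \<Rightarrow> complex) \<Rightarrow> complex \<Rightarrow> complex \<Rightarrow> complex" where
  "dirichlet c a s = (\<Sum>n. c n * (of_nat n + a) powr (- s))"

definition rem_series :: "nat \<Rightarrow> (nat \<Rightarrow> complex) \<Rightarrow> complex \<Rightarrow> complex \<Rightarrow> complex" where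
  "rem_series K c a s = (\<Sum>n. c n * binom_rem K (of_nat n + a) (1 - s))"

lemma of_nat_add_nonzero:
  fixes a :: complex
  assumes "a \<notin> \<int>\<^sub>\<le>\<^sub>0"
  shows "of_nat n + a \<noteq> 0"
  using assms plus_of_nat_eq_0_imp[of a n] by (auto simp: add.commute)

lemma of_nat_add_add_one_nonzero:
  fixes a :: complex
  assumes "a \<notin> \<int>\<^sub>\<le>\<^sub>0"
  shows "of_nat n + a + 1 \<noteq> 0"
  using of_nat_add_nonzero[OF assms, of "Suc n"] by (simp add: add_ac)

lemma dirichlet_props:
  assumes c: "subpoly c" and a: "a \<notin> \<int>\<^sub>\<le>\<^sub>0" and s: "Re s > 1"
  shows summable_dirichlet: "summable (\<lambda>n. c n * (of_nat n + a) powr (- s))"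
    and has_field_derivative_dirichlet: "(dirichlet c a has_field_derivative
          (\<Sum>n. c n * - (Ln (of_nat n + a) * (of_nat n + a) powr (- s)))) (at s)"
proof -
  have der: "((\<lambda>s. (of_nat n + a) powr (- s)) has_field_derivative
          - (Ln (of_nat n + a) * (of_nat n + a) powr (- s))) (at s)" for n s
    using of_nat_add_nonzero[OF a, of n] by (auto simp: powr_def intro!: derivative_eq_intros)
  have bound: "\<exists>C. \<forall>n s. 4 \<le> Re (of_nat n + a) \<longrightarrow> norm s \<le> real M \<longrightarrow>
          norm ((of_nat n + a) powr (- s)) \<le> C * norm (of_nat n + a) powr (- Re s - 0)" for M
    using norm_powr_le_cball[of "- _" "real M" "of_nat _ + a"] by auto
  \<comment> \<open>The literal 0 selects q = 0 in the comparison lemma.\<close>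
  have s': "Re s > 1 - 0" using s by simp
  note comparison = series_comparison_halfplane[OF c der bound s']
  show "summable (\<lambda>n. c n * (of_nat n + a) powr (- s))"
    by (rule comparison(1))
  show "(dirichlet c a has_field_derivative
          (\<Sum>n. c n * - (Ln (of_nat n + a) * (of_nat n + a) powr (- s)))) (at s)"
    unfolding dirichlet_def [abs_def] by (rule comparison(2))
qed

text \<open>The remainder decays with exponent - Re s - K, so the comparison lemma applies with q =
  K. The derivative is kept as an explicit series because its value at s = 1 produces
  \<open>Digamma\<close>.\<close>

lemma rem_series_props:
  assumes c: "subpoly c" and a: "a \<notin> \<int>\<^sub>\<le>\<^sub>0" and s: "Re s > 1 - real K"
  shows summable_rem_series: "summable (\<lambda>n. c n * binom_rem K (of_nat n + a) (1 - s))"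
    and has_field_derivative_rem_series:
      "(rem_series K c a has_field_derivative
         (\<Sum>n. c n * - deriv (binom_rem K (of_nat n + a)) (1 - s))) (at s)"
    and summable_deriv_rem_series:
      "summable (\<lambda>n. c n * - deriv (binom_rem K (of_nat n + a)) (1 - s))"
proof -
  have der: "((\<lambda>s. binom_rem K (of_nat n + a) (1 - s)) has_field_derivative
               - deriv (binom_rem K (of_nat n + a)) (1 - s)) (at s)" for n s
  proof -
    have "binom_rem K (of_nat n + a) field_differentiable at (1 - s)"
      using of_nat_add_nonzero[OF a, of n] of_nat_add_add_one_nonzero[OF a, of n]
      unfolding binom_rem_def gbinomial_prod_rev
      by (intro holomorphic_on_imp_differentiable_at[of _ UNIV] holomorphic_intros) auto
    moreover have "((\<lambda>s :: complex. 1 - s) has_field_derivative - 1) (at s)"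
      by (auto intro!: derivative_eq_intros)
    ultimately show ?thesis
      using DERIV_chain2[OF field_differentiable_derivI] by fastforce
  qed
  have bound: "\<exists>C. \<forall>n s. 4 \<le> Re (of_nat n + a) \<longrightarrow> norm s \<le> real M \<longrightarrow>
          norm (binom_rem K (of_nat n + a) (1 - s)) \<le> C * norm (of_nat n + a) powr (- Re s - real K)" for M
  proof (intro exI allI impI)
    fix n :: nat and s :: complex assume *: "4 \<le> Re (of_nat n + a)" "norm s \<le> real M"
    have "norm (1 - s) \<le> real (Suc M)"
      using norm_triangle_ineq4[of 1 s] * by simp
    from norm_binom_rem_le[OF *(1) this, of K]
    show "norm (binom_rem K (of_nat n + a) (1 - s)) \<le>
        (exp (pi * real (Suc M)) * 2 ^ (Suc M + K + 2)) * norm (of_nat n + a) powr (- Re s - real K)"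
      by (simp add: algebra_simps)
  qed
  note comparison = series_comparison_halfplane[OF c der bound s]
  show "summable (\<lambda>n. c n * binom_rem K (of_nat n + a) (1 - s))"
    by (rule comparison(1))
  show "(rem_series K c a has_field_derivative
         (\<Sum>n. c n * - deriv (binom_rem K (of_nat n + a)) (1 - s))) (at s)"
    unfolding rem_series_def [abs_def] by (rule comparison(2))
  show "summable (\<lambda>n. c n * - deriv (binom_rem K (of_nat n + a)) (1 - s))"
    by (rule comparison(3))
qed

lemma holomorphic_rem_series:
  assumes "subpoly c" "a \<notin> \<int>\<^sub>\<le>\<^sub>0"
  shows "rem_series K c a holomorphic_on {s. Re s > 1 - real K}"
  using has_field_derivative_rem_series[OF assms]
  by (subst holomorphic_on_open) (auto simp: open_halfspace_Re_gt)

text \<open>Telescoping evaluates this sum whatever the branch of the powers is.\<close>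

definition difference_sums :: "(nat \<Rightarrow> complex) \<Rightarrow> complex \<Rightarrow> complex \<Rightarrow> complex \<Rightarrow> bool" where
  "difference_sums c a s E \<longleftrightarrow>
     (\<lambda>n. c n * ((of_nat n + a) powr (1 - s) - (of_nat n + a + 1) powr (1 - s))) sums E"

text \<open>The definition of \<open>binom_rem\<close> expands (n + a + 1)^(1 - s) termwise;
  multiplying by c n and summing sends the k-th binomial term to the series at s + k - 1. The k = 1
  term carries the factor 1 - s and the unshifted argument.\<close>

lemma dirichlet_recursion:
  assumes c: "subpoly c" and a: "a \<notin> \<int>\<^sub>\<le>\<^sub>0" and s: "Re s > 1" and E: "difference_sums c a s E"
  shows "(\<Sum>k=1..K. (1 - s gchoose k) * dirichlet c a (s + of_nat k - 1)) + rem_series K c a s + E = 0"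
proof -
  have "(\<lambda>n. (1 - s gchoose k) * (c n * (of_nat n + a) powr (- (s + of_nat k - 1)))) sums
          ((1 - s gchoose k) * dirichlet c a (s + of_nat k - 1))" if "k \<in> {1..K}" for k
    unfolding dirichlet_def
    by (intro sums_mult summable_sums summable_dirichlet c a) (use that s in auto)
  hence "(\<lambda>n. \<Sum>k=1..K. (1 - s gchoose k) * (c n * (of_nat n + a) powr (- (s + of_nat k - 1)))) sums
          (\<Sum>k=1..K. (1 - s gchoose k) * dirichlet c a (s + of_nat k - 1))"
    by (rule sums_sum)
  moreover have "(\<lambda>n. c n * binom_rem K (of_nat n + a) (1 - s)) sums rem_series K c a s"
    unfolding rem_series_def by (intro summable_sums summable_rem_series c a) (use s in simp)
  ultimately have "(\<lambda>n. (\<Sum>k=1..K. (1 - s gchoose k) * (c n * (of_nat n + a) powr (- (s + of_nat k - 1)))) +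
      c n * binom_rem K (of_nat n + a) (1 - s) +
      c n * ((of_nat n + a) powr (1 - s) - (of_nat n + a + 1) powr (1 - s))) sums
      ((\<Sum>k=1..K. (1 - s gchoose k) * dirichlet c a (s + of_nat k - 1)) + rem_series K c a s + E)"
    using E unfolding difference_sums_def by (intro sums_add)
  moreover have "(\<Sum>k=1..K. (1 - s gchoose k) * (c n * (of_nat n + a) powr (- (s + of_nat k - 1)))) +
      c n * binom_rem K (of_nat n + a) (1 - s) +
      c n * ((of_nat n + a) powr (1 - s) - (of_nat n + a + 1) powr (1 - s)) = 0" for n
  proof -
    have "{..K} = insert 0 {1..K}" by auto
    hence "(\<Sum>k\<le>K. (1 - s gchoose k) * (of_nat n + a) powr (1 - s - of_nat k)) =
        (of_nat n + a) powr (1 - s) + (\<Sum>k=1..K. (1 - s gchoose k) * (of_nat n + a) powr (- (s + of_nat k - 1)))"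
      by (simp add: algebra_simps)
    thus ?thesis
      by (simp add: binom_rem_def sum_distrib_left algebra_simps)
  qed
  ultimately have "(\<lambda>n. 0) sums ((\<Sum>k=1..K. (1 - s gchoose k) * dirichlet c a (s + of_nat k - 1)) +
      rem_series K c a s + E)"
    by (simp only:)
  thus ?thesis
    by (rule sums_unique2[OF _ sums_zero])
qed

section \<open>Continuation strip by strip\<close>

lemma gbinomial_meromorphic:
  "(\<lambda>s. (1 - s gchoose k) :: complex) meromorphic_on A"
  unfolding gbinomial_prod_rev by (intro meromorphic_intros)

lemma meromorphic_on_shift:
  fixes b :: complex
  assumes "f meromorphic_on A" "\<And>s. s \<in> B \<Longrightarrow> s + b \<in> A"
  shows "(\<lambda>s. f (s + b)) meromorphic_on B"
  by (rule meromorphic_on_compose[OF assms(1)]) (use assms(2) in \<open>auto intro!: analytic_intros\<close>)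

lemma connected_halfplane_Re_gt: "connected {s. Re s > b}"
  by (intro convex_connected convex_halfspace_Re_gt)

text \<open>The identity theorem for meromorphic functions. Equality is claimed only on a punctured
  neighbourhood, since values at isolated points may be arbitrary.\<close>

lemma meromorphic_eventually_eq:
  assumes f: "f meromorphic_on A" and g: "g meromorphic_on A" and A: "open A" "connected A"
    and S: "open S" "S \<noteq> {}" "S \<subseteq> A" and eq: "\<And>s. s \<in> S \<Longrightarrow> f s = g s" and z: "z \<in> A"
  shows "\<forall>\<^sub>F s in at z. f s = g s"
proof -
  have mero: "(\<lambda>s. f s - g s) meromorphic_on A"
    by (intro meromorphic_intros f g)
  have "(\<forall>\<^sub>\<approx>s\<in>A. f s - g s = 0) \<or> (\<forall>\<^sub>\<approx>s\<in>A. f s - g s \<noteq> 0)"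
    by (rule meromorphic_imp_constant_or_avoid[OF mero A])
  moreover have "\<not> (\<forall>\<^sub>\<approx>s\<in>A. f s - g s \<noteq> 0)"
  proof
    assume *: "\<forall>\<^sub>\<approx>s\<in>A. f s - g s \<noteq> 0"
    from S obtain w where w: "w \<in> S" "w \<in> A" by auto
    from * w A have "\<forall>\<^sub>F s in at w. f s - g s \<noteq> 0"
      by (simp add: eventually_cosparse_open_eq)
    moreover have "\<forall>\<^sub>F s in at w. s \<in> S"
      using S(1) w(1) by (rule eventually_at_in_open')
    ultimately have "\<forall>\<^sub>F s in at w. False"
      by eventually_elim (auto simp: eq)
    thus False by simp
  qed
  ultimately have "\<forall>\<^sub>\<approx>s\<in>A. f s - g s = 0"
    by blast
  thus ?thesis
    using A z by (simp add: eventually_cosparse_open_eq)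
qed

text \<open>Continuations to two of the growing half-planes agree near every common point by the
  identity theorem. \<open>remove_sings\<close> turns this into equality at every point, so a value
  may be read from any half-plane containing the point.\<close>

lemma mero_continuation_glue:
  assumes "\<And>j::nat. \<exists>F. F meromorphic_on {s. Re s > 1 - real j} \<and> (\<forall>s. Re s > 1 \<longrightarrow> F s = f s)"
  shows "\<exists>F. F meromorphic_on UNIV \<and> (\<forall>s. Re s > 1 \<longrightarrow> F s = f s)"
proof -
  define S :: "nat \<Rightarrow> complex set" where "S = (\<lambda>j. {s. Re s > 1 - real j})"
  have S: "open (S j)" "connected (S j)" "S 0 \<subseteq> S j" for j
    by (auto simp: S_def open_halfspace_Re_gt connected_halfplane_Re_gt)
  have S0: "S 0 \<noteq> {}" by (auto simp: S_def intro: exI[of _ 2])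
  have "\<exists>F. \<forall>j. F j meromorphic_on S j \<and> (\<forall>s. s \<in> S 0 \<longrightarrow> F j s = f s)"
    using assms by (intro choice) (simp add: S_def)
  then obtain F where F: "\<And>j. F j meromorphic_on S j" "\<And>j s. s \<in> S 0 \<Longrightarrow> F j s = f s"
    by blast
  \<comment> \<open>Any index j with Re s > 1 - j would do; rounding 2 - Re s up leaves a
    margin.\<close>
  define J where "J = (\<lambda>s. nat \<lceil>2 - Re s\<rceil>)"
  \<comment> \<open>On \<open>S 0\<close> the prescribed values are kept, since
    \<open>remove_sings\<close> could alter an f that is not known to be continuous there.\<close>
  define G where "G = (\<lambda>s. if s \<in> S 0 then f s else remove_sings (F (J s)) s)"
  have eq: "remove_sings (F i) s = remove_sings (F j) s" if "s \<in> S i" "i \<le> j" for i j s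
  proof (rule remove_sings_cong)
    have "S i \<subseteq> S j" using that by (auto simp: S_def)
    hence "F j meromorphic_on S i" using F(1) meromorphic_on_subset by blast
    thus "\<forall>\<^sub>F x in at s. F i x = F j x"
      using F S S0 that(1) by (intro meromorphic_eventually_eq[where A = "S i" and S = "S 0"]) auto
  qed auto
  have JS: "s \<in> S (J s)" for s
    unfolding S_def J_def mem_Collect_eq by linarith
  have "remove_sings (F (J s)) s = remove_sings (F j) s" if "s \<in> S j" for s j
    using eq[OF JS, of s j] eq[OF that, of "J s"] by (metis linear)
  hence G: "G s = (if s \<in> S 0 then F j s else remove_sings (F j) s)" if "s \<in> S j" for s j
    using that F(2) unfolding G_def by auto
  have "G meromorphic_on {s}" for s
  proof -
    let ?j = "J s"
    have mero: "F ?j meromorphic_on {s}"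
      using F(1) JS by (auto intro: meromorphic_on_subset)
    have "\<forall>\<^sub>F x in at s. x \<in> S ?j"
      using S(1) JS by (rule eventually_at_in_open')
    moreover have "\<forall>\<^sub>F x in at s. remove_sings (F ?j) x = F ?j x"
      using mero by (intro eventually_remove_sings_eq_at meromorphic_on_isolated_singularity)
    ultimately have "\<forall>\<^sub>F x in at s. G x = F ?j x"
      by eventually_elim (auto simp: G)
    thus ?thesis
      using mero meromorphic_on_cong[of "{s}" G "F ?j" "{s}"] by auto
  qed
  hence "G meromorphic_on UNIV"
    using meromorphic_on_meromorphic_at by blast
  thus ?thesis
    by (intro exI[of _ G]) (auto simp: G_def S_def)
qed

text \<open>Induction on the strip: the recursion of order j + 1 is solved for its k = 1 term. All
  terms with k \<ge> 2 have arguments shifted right by at least 1, where the previous continuation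
  is available, and the remainder is holomorphic on the larger half-plane.\<close>

lemma dirichlet_continuation:
  assumes c: "subpoly c" and a: "a \<notin> \<int>\<^sub>\<le>\<^sub>0" and E: "E meromorphic_on UNIV"
    and diff: "\<And>s. Re s > 1 \<Longrightarrow> difference_sums c a s (E s)"
  shows "\<exists>F. F meromorphic_on UNIV \<and> (\<forall>s. Re s > 1 \<longrightarrow> F s = dirichlet c a s)"
proof (rule mero_continuation_glue)
  fix j :: nat
  show "\<exists>F. F meromorphic_on {s. Re s > 1 - real j} \<and> (\<forall>s. Re s > 1 \<longrightarrow> F s = dirichlet c a s)"
  proof (induction j)
    case 0
    have "dirichlet c a holomorphic_on {s. Re s > 1}"
      using has_field_derivative_dirichlet[OF c a]
      by (subst holomorphic_on_open) (auto simp: open_halfspace_Re_gt)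
    hence "dirichlet c a meromorphic_on {s. Re s > 1 - real 0}"
      by (intro analytic_on_imp_meromorphic_on) (simp add: analytic_on_open open_halfspace_Re_gt)
    thus ?case by blast
  next
    case (Suc j)
    then obtain F where F: "F meromorphic_on {s. Re s > 1 - real j}"
      "\<And>s. Re s > 1 \<Longrightarrow> F s = dirichlet c a s" by blast
    let ?S = "{s. Re s > 1 - real (Suc j)}"
    define G where "G = (\<lambda>s. ((\<Sum>k=2..Suc j. (1 - s gchoose k) * F (s + (of_nat k - 1))) +
        rem_series (Suc j) c a s + E s) / (s - 1))"
    have "rem_series (Suc j) c a meromorphic_on ?S"
      using holomorphic_rem_series[OF c a, of "Suc j"]
      by (intro analytic_on_imp_meromorphic_on) (simp add: analytic_on_open open_halfspace_Re_gt)
    moreover have "(\<lambda>s. F (s + (of_nat k - 1))) meromorphic_on ?S" if "k \<in> {2..Suc j}" for k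
      using that by (intro meromorphic_on_shift[OF F(1)]) auto
    ultimately have "G meromorphic_on ?S"
      unfolding G_def using E
      by (intro meromorphic_intros gbinomial_meromorphic) (auto intro: meromorphic_on_subset)
    moreover have "G s = dirichlet c a s" if s: "Re s > 1" for s
    proof -
      define T where "T = (\<Sum>k=2..Suc j. (1 - s gchoose k) * F (s + (of_nat k - 1)))"
      have "(\<Sum>k=1..Suc j. (1 - s gchoose k) * dirichlet c a (s + of_nat k - 1)) =
              (1 - s) * dirichlet c a s +
              (\<Sum>k=Suc 1..Suc j. (1 - s gchoose k) * dirichlet c a (s + of_nat k - 1))"
        by (subst sum.atLeast_Suc_atMost) simp_all
      also have "(\<Sum>k=Suc 1..Suc j. (1 - s gchoose k) * dirichlet c a (s + of_nat k - 1)) = T"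
        unfolding T_def by (intro sum.cong) (use s in \<open>auto simp: F(2) add_diff_eq\<close>)
      finally have "(1 - s) * dirichlet c a s + T + rem_series (Suc j) c a s + E s = 0"
        using dirichlet_recursion[OF c a s diff[OF s], of "Suc j"] by simp
      hence "(s - 1) * dirichlet c a s = T + rem_series (Suc j) c a s + E s"
        by (simp add: algebra_simps add_eq_0_iff)
      moreover have "s - 1 \<noteq> 0" using s by auto
      ultimately show ?thesis unfolding G_def T_def[symmetric] by (simp add: field_simps)
    qed
    ultimately show ?case by blast
  qed
qed

text \<open>The left side is meromorphic on Re s > 1 - K and vanishes for Re s > 1, so the identity
  theorem carries the recursion to the whole half-plane.\<close>

lemma dirichlet_continuation_recursion:
  assumes c: "subpoly c" and a: "a \<notin> \<int>\<^sub>\<le>\<^sub>0" and E: "E meromorphic_on UNIV"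
    and diff: "\<And>s. Re s > 1 \<Longrightarrow> difference_sums c a s (E s)"
    and F: "F meromorphic_on UNIV" "\<And>s. Re s > 1 \<Longrightarrow> F s = dirichlet c a s"
    and z: "Re z > 1 - real K"
  shows "\<forall>\<^sub>F s in at z. (\<Sum>k=1..K. (1 - s gchoose k) * F (s + (of_nat k - 1))) + rem_series K c a s + E s = 0"
proof (rule meromorphic_eventually_eq)
  let ?A = "{s. Re s > 1 - real K}"
  have "rem_series K c a meromorphic_on ?A"
    using holomorphic_rem_series[OF c a, of K]
    by (intro analytic_on_imp_meromorphic_on) (simp add: analytic_on_open open_halfspace_Re_gt)
  moreover have "(\<lambda>s. F (s + (of_nat k - 1))) meromorphic_on ?A" for k
    by (intro meromorphic_on_shift[OF F(1)]) auto
  ultimately show "(\<lambda>s. (\<Sum>k=1..K. (1 - s gchoose k) * F (s + (of_nat k - 1))) +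
      rem_series K c a s + E s) meromorphic_on ?A"
    using E by (intro meromorphic_intros gbinomial_meromorphic) (auto intro: meromorphic_on_subset)
  show "open ?A" "connected ?A" "z \<in> ?A"
    using z by (auto simp: open_halfspace_Re_gt connected_halfplane_Re_gt)
  show "open {s. Re s > 1}" "{s. Re s > 1} \<noteq> {}" "{s. Re s > 1} \<subseteq> ?A"
    by (auto simp: open_halfspace_Re_gt intro: exI[of _ 2])
  fix s assume "s \<in> {s. Re s > 1}"
  hence s: "Re s > 1" by simp
  show "(\<Sum>k=1..K. (1 - s gchoose k) * F (s + (of_nat k - 1))) + rem_series K c a s + E s = 0"
    using dirichlet_recursion[OF c a s diff[OF s], of K] s by (simp add: F(2) add_diff_eq)
qed auto

section \<open>The Hurwitz zeta function and its harmonic analogue\<close>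

lemma subpolyI_ln:
  assumes "\<And>n. norm (c n) \<le> ln (real n + 1) + B"
  shows "subpoly c"
  unfolding subpoly_def
proof safe
  fix e :: real assume e: "e > 0"
  have "(\<lambda>n. ln (real n + 1) + B) \<in> O(\<lambda>n. real n powr e)"
    using e by real_asymp
  then obtain C where "C > 0" "\<forall>\<^sub>F n in sequentially. norm (ln (real n + 1) + B) \<le> C * norm (real n powr e)"
    by (elim landau_o.bigE)
  from this(2) have "\<forall>\<^sub>F n in sequentially. norm (c n) \<le> C * norm (of_real (real n powr e) :: complex)"
  proof eventually_elim
    case (elim n)
    thus ?case using assms[of n] by simp
  qed
  thus "c \<in> O(\<lambda>n. of_real (real n powr e))" by (rule bigoI)
qed

lemma subpoly_const: "subpoly (\<lambda>_. c)"
  by (rule subpolyI_ln[where B = "norm c"]) simp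

text \<open>By the limit formula for \<open>Digamma\<close>, ln m minus the sum of the first m
  reciprocals converges, hence is bounded. \<open>H n a\<close> has n + 1 terms, so m = n +
  1.\<close>

lemma subpoly_H:
  assumes a: "a \<noteq> 0"
  shows "subpoly (\<lambda>n. H n a)"
proof -
  define X where "X = (\<lambda>m. of_real (ln (real m)) - (\<Sum>n<m. inverse (a + of_nat n)))"
  have "convergent X"
    using Digamma_LIMSEQ[OF a] unfolding X_def convergent_def by blast
  then obtain B where B: "\<And>m. norm (X m) \<le> B"
    using convergent_imp_Bseq BseqE by metis
  have "H n a = of_real (ln (real n + 1)) - X (Suc n)" for n
    by (simp add: X_def H_def lessThan_Suc_atMost inverse_eq_divide add.commute)
  hence "norm (H n a) \<le> ln (real n + 1) + B" for n
    using norm_triangle_ineq4[of "of_real (ln (real n + 1))" "X (Suc n)"] B[of "Suc n"] by simp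
  thus ?thesis by (rule subpolyI_ln)
qed

text \<open>Half of the decay of the power is spent on the coefficients and the other half remains.
  This removes the boundary terms at infinity in the telescoping sums below.\<close>

lemma subpoly_mult_powr_tendsto_0:
  assumes c: "subpoly c" and w: "Re w < 0"
  shows "(\<lambda>n. c n * (of_nat n + a) powr w) \<longlonglongrightarrow> 0"
proof -
  define r where "r = - Re w / 2"
  have r: "r > 0" using w by (simp add: r_def)
  have "c \<in> O(\<lambda>n. of_real (real n powr r))"
    using c r unfolding subpoly_def by blast
  then obtain B where B: "B > 0" "\<forall>\<^sub>F n in sequentially. norm (c n) \<le> B * norm (of_real (real n powr r) :: complex)"
    by (elim landau_o.bigE)
  define K where "K = exp (pi * norm w) * 2 powr (2 * r)"
  have "\<forall>\<^sub>F n in sequentially. norm (c n * (of_nat n + a) powr w) \<le> B * K * real n powr (- r)"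
    using B(2) eventually_norm_of_nat_add_ge[of 0 a] eventually_gt_at_top[of 0]
  proof eventually_elim
    case (elim n)
    have "norm ((of_nat n + a) powr w) \<le> exp (pi * norm w) * norm (of_nat n + a) powr (- (2 * r))"
      using norm_powr_le_cball[of w "norm w" "of_nat n + a"] by (simp add: r_def)
    also have "\<dots> \<le> exp (pi * norm w) * (real n / 2) powr (- (2 * r))"
      using elim r by (intro mult_left_mono powr_mono2') auto
    also have "\<dots> = K * real n powr (- (2 * r))"
      unfolding K_def using powr_minus_divide[of 2 "2 * r"] by (simp add: powr_divide)
    finally have "norm (c n * (of_nat n + a) powr w) \<le>
        (B * real n powr r) * (K * real n powr (- (2 * r)))"
      unfolding norm_mult using elim(1) B(1) by (intro mult_mono) auto
    also have "\<dots> = B * K * real n powr (r + - (2 * r))"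
      unfolding powr_add by (simp add: mult_ac)
    finally show ?case by simp
  qed
  moreover have "(\<lambda>n. B * K * real n powr (- r)) \<longlonglongrightarrow> 0"
    using r by (intro tendsto_mult_right_zero tendsto_neg_powr filterlim_real_sequentially) auto
  ultimately show ?thesis by (rule Lim_null_comparison)
qed

lemma difference_sums_const:
  assumes s: "Re s > 1"
  shows "difference_sums (\<lambda>_. 1) a s (a powr (1 - s))"
proof -
  have "(\<lambda>n. (of_nat n + a) powr (1 - s)) \<longlonglongrightarrow> 0"
    using subpoly_mult_powr_tendsto_0[OF subpoly_const[of 1], of "1 - s" a] s by simp
  from telescope_sums'[OF this] show ?thesis
    by (simp add: difference_sums_def add_ac)
qed

text \<open>Abel summation: the increment 1 / (n + 1 + a) of the harmonic sum turns (n + 1 + a)^(1 -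
  s) into (n + 1 + a)^(-s). The boundary term \<open>f 0\<close> is the missing n = 0 term of the
  zeta series.\<close>

lemma difference_sums_H:
  assumes a: "a \<notin> \<int>\<^sub>\<le>\<^sub>0" and s: "Re s > 1"
  shows "difference_sums (\<lambda>n. H n a) a s (dirichlet (\<lambda>_. 1) a s)"
proof -
  have a0: "a \<noteq> 0" using a by auto
  define f where "f = (\<lambda>n. H n a * (of_nat n + a) powr (1 - s))"
  have "f \<longlonglongrightarrow> 0"
    unfolding f_def by (intro subpoly_mult_powr_tendsto_0 subpoly_H a0) (use s in simp)
  hence "(\<lambda>n. f n - f (Suc n)) sums (f 0 - 0)"
    by (rule telescope_sums')
  moreover have "f 0 = a powr (- s)"
    using a0 by (simp add: f_def H_def powr_diff powr_minus_divide)
  moreover have "(\<lambda>n. (of_nat n + a) powr (- s)) sums dirichlet (\<lambda>_. 1) a s"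
    using summable_dirichlet[OF subpoly_const[of 1] a s] by (simp add: dirichlet_def summable_sums)
  hence "(\<lambda>n. (of_nat (Suc n) + a) powr (- s)) sums (dirichlet (\<lambda>_. 1) a s - a powr (- s))"
    by (subst sums_Suc_iff) simp
  ultimately have "(\<lambda>n. (f n - f (Suc n)) + (of_nat (Suc n) + a) powr (- s)) sums
      (a powr (- s) + (dirichlet (\<lambda>_. 1) a s - a powr (- s)))"
    by (intro sums_add) simp_all
  moreover have "(f n - f (Suc n)) + (of_nat (Suc n) + a) powr (- s) =
      H n a * ((of_nat n + a) powr (1 - s) - (of_nat n + a + 1) powr (1 - s))" for n
  proof -
    have nz: "of_nat (Suc n) + a \<noteq> 0" using a by (rule of_nat_add_nonzero)
    hence "(of_nat (Suc n) + a) powr (- s) = (of_nat (Suc n) + a) powr (1 - s) / (of_nat (Suc n) + a)"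
      by (simp add: powr_diff powr_minus_divide)
    moreover have "H (Suc n) a = H n a + 1 / (of_nat (Suc n) + a)"
      by (simp add: H_def)
    moreover have "of_nat n + a + 1 = of_nat (Suc n) + a" by simp
    ultimately show ?thesis unfolding f_def by (simp only: ring_distribs) simp
  qed
  ultimately show ?thesis by (simp add: difference_sums_def)
qed

text \<open>Normalising a continuation F with \<open>remove_sings\<close> makes it nicely
  meromorphic. It leaves the values on Re s > 1 unchanged because F is holomorphic there, so
  uniqueness identifies the result.\<close>

lemma mero_continuation_dirichlet:
  assumes c: "subpoly c" and a: "a \<notin> \<int>\<^sub>\<le>\<^sub>0" and E: "E meromorphic_on UNIV"
    and diff: "\<And>s. Re s > 1 \<Longrightarrow> difference_sums c a s (E s)"
  shows "mero_continuation {s. Re s > 1} (dirichlet c a) nicely_meromorphic_on UNIV"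
    and "Re s > 1 \<Longrightarrow> mero_continuation {s. Re s > 1} (dirichlet c a) s = dirichlet c a s"
proof -
  let ?S = "{s :: complex. Re s > 1}"
  obtain F where F: "F meromorphic_on UNIV" "\<And>s. Re s > 1 \<Longrightarrow> F s = dirichlet c a s"
    using dirichlet_continuation[OF assms] by blast
  have eq: "remove_sings F s = dirichlet c a s" if "s \<in> ?S" for s
  proof -
    have "dirichlet c a holomorphic_on ?S"
      using has_field_derivative_dirichlet[OF c a]
      by (subst holomorphic_on_open) (auto simp: open_halfspace_Re_gt)
    hence "F holomorphic_on ?S"
      by (rule holomorphic_transform) (simp add: F(2))
    hence "F analytic_on {s}"
      using that by (intro holomorphic_on_imp_analytic_at[of _ ?S]) (auto simp: open_halfspace_Re_gt)
    thus ?thesis using F(2) that by simp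
  qed
  have cont: "mero_continuation ?S (dirichlet c a) = remove_sings F"
    by (rule mero_continuation_eqI)
       (use eq in \<open>auto simp: open_halfspace_Re_gt intro: exI[of _ 2]
         intro!: remove_sings_nicely_meromorphic[OF F(1)]\<close>)
  show "mero_continuation ?S (dirichlet c a) nicely_meromorphic_on UNIV"
    unfolding cont by (rule remove_sings_nicely_meromorphic[OF F(1)])
  show "mero_continuation ?S (dirichlet c a) s = dirichlet c a s" if "Re s > 1"
    unfolding cont using eq that by simp
qed

section \<open>The two zeta functions as continued Dirichlet series\<close>

lemma hurwitz_zeta_eq_dirichlet_continuation:
  "(\<lambda>s. hurwitz_zeta s a) = mero_continuation {s. Re s > 1} (dirichlet (\<lambda>_. 1) a)"
  by (simp add: hurwitz_zeta_def dirichlet_def [abs_def])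

lemma zeta_H_eq_dirichlet_continuation:
  "(\<lambda>s. zeta_H s a) = mero_continuation {s. Re s > 1} (dirichlet (\<lambda>n. H n a) a)"
  by (simp add: zeta_H_def dirichlet_def [abs_def] powr_minus_divide)

text \<open>The continuation argument runs twice: first with the entire function a^(1 - s) as E,
  then with the Hurwitz zeta function just obtained as E for the harmonic coefficients.\<close>

lemma
  assumes a: "a \<notin> \<int>\<^sub>\<le>\<^sub>0"
  shows nicely_meromorphic_hurwitz_zeta: "(\<lambda>s. hurwitz_zeta s a) nicely_meromorphic_on UNIV"
    and hurwitz_zeta_recursion: "Re z > 1 - real K \<Longrightarrow>
      \<forall>\<^sub>F s in at z. (\<Sum>k=1..K. (1 - s gchoose k) * hurwitz_zeta (s + (of_nat k - 1)) a) +
        rem_series K (\<lambda>_. 1) a s + a powr (1 - s) = 0"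
    and nicely_meromorphic_zeta_H: "(\<lambda>s. zeta_H s a) nicely_meromorphic_on UNIV"
    and zeta_H_recursion: "Re z > 1 - real K \<Longrightarrow>
      \<forall>\<^sub>F s in at z. (\<Sum>k=1..K. (1 - s gchoose k) * zeta_H (s + (of_nat k - 1)) a) +
        rem_series K (\<lambda>n. H n a) a s + hurwitz_zeta s a = 0"
proof -
  have a0: "a \<noteq> 0" using a by auto
  have E: "(\<lambda>s. a powr (1 - s)) meromorphic_on UNIV"
    using a0 by (intro analytic_on_imp_meromorphic_on) (auto simp: powr_def intro!: analytic_intros)
  note 1 = subpoly_const[of 1] a E difference_sums_const
  note cont1 = mero_continuation_dirichlet[OF 1, folded hurwitz_zeta_eq_dirichlet_continuation]
  show nice1: "(\<lambda>s. hurwitz_zeta s a) nicely_meromorphic_on UNIV"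
    by (rule cont1(1))
  hence mero1: "(\<lambda>s. hurwitz_zeta s a) meromorphic_on UNIV"
    by (simp add: nicely_meromorphic_on_def)
  have eq1: "hurwitz_zeta s a = dirichlet (\<lambda>_. 1) a s" if "Re s > 1" for s
    using cont1(2) that by simp
  show "Re z > 1 - real K \<Longrightarrow>
      \<forall>\<^sub>F s in at z. (\<Sum>k=1..K. (1 - s gchoose k) * hurwitz_zeta (s + (of_nat k - 1)) a) +
        rem_series K (\<lambda>_. 1) a s + a powr (1 - s) = 0"
    by (rule dirichlet_continuation_recursion[OF 1 mero1 eq1])
  have "difference_sums (\<lambda>n. H n a) a s (hurwitz_zeta s a)" if "Re s > 1" for s
    using difference_sums_H[OF a that] eq1[OF that] by simp
  note 2 = subpoly_H[OF a0] a mero1 this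
  note cont2 = mero_continuation_dirichlet[OF 2, folded zeta_H_eq_dirichlet_continuation]
  show nice2: "(\<lambda>s. zeta_H s a) nicely_meromorphic_on UNIV"
    by (rule cont2(1))
  hence mero2: "(\<lambda>s. zeta_H s a) meromorphic_on UNIV"
    by (simp add: nicely_meromorphic_on_def)
  have eq2: "zeta_H s a = dirichlet (\<lambda>n. H n a) a s" if "Re s > 1" for s
    using cont2(2) that by simp
  show "Re z > 1 - real K \<Longrightarrow>
      \<forall>\<^sub>F s in at z. (\<Sum>k=1..K. (1 - s gchoose k) * zeta_H (s + (of_nat k - 1)) a) +
        rem_series K (\<lambda>n. H n a) a s + hurwitz_zeta s a = 0"
    by (rule dirichlet_continuation_recursion[OF 2 mero2 eq2])
qed

section \<open>Values and derivative of the remainder series at 1 and 0\<close>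

lemma rem_series_1_at_1:
  assumes "a \<notin> \<int>\<^sub>\<le>\<^sub>0"
  shows "rem_series 1 c a 1 = 0"
  using of_nat_add_nonzero[OF assms] of_nat_add_add_one_nonzero[OF assms]
  by (simp add: rem_series_def binom_rem_def)

text \<open>At s = 0 the exponent 1 - s is 1 and the binomial expansion is exact, so every summand
  vanishes. At s = 1 the same happens with exponent 0.\<close>

lemma rem_series_2_at_0:
  assumes "a \<notin> \<int>\<^sub>\<le>\<^sub>0"
  shows "rem_series 2 c a 0 = 0"
  using of_nat_add_nonzero[OF assms] of_nat_add_add_one_nonzero[OF assms]
  by (simp add: rem_series_def binom_rem_def numeral_2_eq_2 gbinomial_prod_rev)

lemma deriv_binom_rem_1_at_0:
  assumes "z \<noteq> 0" "z + 1 \<noteq> 0"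
  shows "deriv (binom_rem 1 z) 0 = Ln (z + 1) - Ln z - 1 / z"
proof -
  have "binom_rem 1 z = (\<lambda>w. exp (w * Ln (z + 1)) - exp (w * Ln z) - w * exp (w * Ln z) / z)"
    using assms by (auto simp: binom_rem_def powr_def fun_eq_iff left_diff_distrib exp_diff)
  moreover have "((\<lambda>w. exp (w * Ln (z + 1)) - exp (w * Ln z) - w * exp (w * Ln z) / z)
      has_field_derivative (Ln (z + 1) - Ln z - 1 / z)) (at 0)"
    using assms by (auto intro!: derivative_eq_intros)
  ultimately show ?thesis
    by (auto intro: DERIV_imp_deriv)
qed

text \<open>The termwise derivatives are 1 / (n + a) minus a difference of consecutive logarithms.
  The logarithms telescope, and comparing Ln(N + a) with ln N leaves the limit that defines
  \<open>Digamma\<close>.\<close>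

lemma rem_series_1_deriv_at_1:
  assumes a: "a \<notin> \<int>\<^sub>\<le>\<^sub>0"
  shows "(rem_series 1 (\<lambda>_. 1) a has_field_derivative (Ln a - Digamma a)) (at 1)"
proof -
  have a0: "a \<noteq> 0" using a by auto
  define d where "d = (\<lambda>n. - (Ln (of_nat n + a + 1) - Ln (of_nat n + a) - 1 / (of_nat n + a)))"
  \<comment> \<open>Stated in the unsimplified form that the general derivative series takes for c =
    1 and s = 1.\<close>
  have d: "1 * - deriv (binom_rem 1 (of_nat n + a)) (1 - 1) = d n" for n
    using deriv_binom_rem_1_at_0[OF of_nat_add_nonzero[OF a] of_nat_add_add_one_nonzero[OF a], of n]
    by (simp add: d_def)
  have R: "(rem_series 1 (\<lambda>_. 1) a has_field_derivative (\<Sum>n. d n)) (at 1)" and sd: "summable d"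
    using has_field_derivative_rem_series[OF subpoly_const[of 1] a, of 1 1]
      summable_deriv_rem_series[OF subpoly_const[of 1] a, of 1 1]
    unfolding d by simp_all
  have part: "(\<Sum>n<N. d n) = Ln a - Ln (of_nat N + a) + (\<Sum>n<N. inverse (a + of_nat n))" for N
    by (induction N) (simp_all add: d_def inverse_eq_divide algebra_simps)
  have "(\<lambda>N. a / of_nat N) \<longlonglongrightarrow> 0"
    by (rule lim_const_over_n)
  hence "(\<lambda>N. Ln (1 + a / of_nat N)) \<longlonglongrightarrow> Ln (1 + 0)"
    by (intro tendsto_intros) auto
  hence lim: "(\<lambda>N. Ln (1 + a / of_nat N)) \<longlonglongrightarrow> 0" by simp
  have "(\<lambda>N. Ln a - Ln (1 + a / of_nat N) -
          (of_real (ln (real N)) - (\<Sum>n<N. inverse (a + of_nat n)))) \<longlonglongrightarrow> Ln a - 0 - Digamma a"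
    by (intro tendsto_diff tendsto_const lim Digamma_LIMSEQ a0)
  moreover have "\<forall>\<^sub>F N in sequentially. Ln a - Ln (1 + a / of_nat N) -
          (of_real (ln (real N)) - (\<Sum>n<N. inverse (a + of_nat n))) = (\<Sum>n<N. d n)"
    using eventually_gt_at_top[of 0]
  proof eventually_elim
    case (elim N)
    \<comment> \<open>A positive integer factor splits off \<open>Ln\<close> without a branch
      correction.\<close>
    have eq: "of_nat N * (1 + a / of_nat N) = of_nat N + a"
      using elim by (simp add: field_simps)
    have "1 + a / of_nat N \<noteq> 0"
      using eq of_nat_add_nonzero[OF a, of N] by (metis mult_zero_right)
    with Ln_times_of_nat[of N "1 + a / of_nat N"] elim
    have "Ln (of_nat N + a) = of_real (ln (real N)) + Ln (1 + a / of_nat N)"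
      unfolding eq by simp
    thus ?case by (simp add: part)
  qed
  ultimately have "(\<lambda>N. \<Sum>n<N. d n) \<longlonglongrightarrow> Ln a - Digamma a"
    using Lim_transform_eventually by fastforce
  hence "d sums (Ln a - Digamma a)" by (simp add: sums_def)
  with R show ?thesis by (simp add: sums_iff)
qed

section \<open>Laurent expansion at the origin\<close>

theorem corollary9:
  fixes a :: complex
  assumes "a \<notin> \<int>\<^sub>\<le>\<^sub>0"
  shows "(\<lambda>s. zeta_H s a - (1 / (2 * s) + gamma_H0 0 a)) \<in> O[at 0](\<lambda>s. s)
       \<and> gamma_H0 0 a = - hurwitz_zeta 0 a - Digamma a / 2"
proof -
  have a: "a \<noteq> 0" using assms by auto
  define Z where "Z = (\<lambda>s. hurwitz_zeta s a)"
  define F where "F = (\<lambda>s. zeta_H s a)"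
  define R where "R = (\<lambda>K. rem_series K (\<lambda>_. 1) a)"
  define S where "S = (\<lambda>K. rem_series K (\<lambda>n. H n a) a)"
  have shift: "\<forall>\<^sub>F s in at (0 :: complex). P (s + 1)" if "\<forall>\<^sub>F s in at 1. P s" for P
    using that eventually_at_to_0[of P 1] by simp
  have gb: "(1 - s gchoose 2) = (1 - s) * (- s) / 2" for s :: complex
    by (simp add: gbinomial_prod_rev numeral_2_eq_2)
  have sum2: "(\<Sum>k=1..2. f k) = f 1 + f 2" for f :: "nat \<Rightarrow> complex"
    by (simp add: numeral_2_eq_2)

  \<comment> \<open>Local recursions at 1 and 0\<close>
  have Z1: "\<forall>\<^sub>F s in at 1. (1 - s) * Z s + R 1 s + a powr (1 - s) = 0"
    using hurwitz_zeta_recursion[OF assms, of 1 1] by (simp add: Z_def R_def)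
  have F1: "\<forall>\<^sub>F s in at 1. (1 - s) * F s + S 1 s + Z s = 0"
    using zeta_H_recursion[OF assms, of 1 1] by (simp add: Z_def F_def S_def)
  \<comment> \<open>The half-plane Re s > 1 - K first contains 0 for K = 2; for the point 1 the
    order K = 1 was enough.\<close>
  have Z0: "\<forall>\<^sub>F s in at 0. (1 - s) * Z s + (1 - s) * (- s) / 2 * Z (s + 1) + R 2 s + a powr (1 - s) = 0"
    using hurwitz_zeta_recursion[OF assms, of 2 0] by (simp only: sum2 gb) (simp add: Z_def R_def)
  have F0: "\<forall>\<^sub>F s in at 0. (1 - s) * F s + (1 - s) * (- s) / 2 * F (s + 1) + S 2 s + Z s = 0"
    using zeta_H_recursion[OF assms, of 2 0] by (simp only: sum2 gb) (simp add: Z_def F_def S_def)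

  have RS_holo: "R K holomorphic_on {s. Re s > 1 - real K}" "S K holomorphic_on {s. Re s > 1 - real K}" for K
    unfolding R_def S_def by (intro holomorphic_rem_series subpoly_const subpoly_H a assms)+
  have RS_analytic: "R 2 analytic_on {0}" "S 2 analytic_on {0}"
    by (rule holomorphic_on_imp_analytic_at[OF RS_holo(1)[of 2]]
             holomorphic_on_imp_analytic_at[OF RS_holo(2)[of 2]]; simp add: open_halfspace_Re_gt)+

  \<comment> \<open>Value and derivative at 1 of A = (s - 1) zeta(s,a) and B = (s - 1)^2
    zeta_H(s,a), in forms holomorphic across 1\<close>
  define A where "A = (\<lambda>s. a powr (1 - s) + R 1 s)"
  have A1: "A 1 = 1"
    using a rem_series_1_at_1[OF assms] by (simp add: A_def R_def)
  \<comment> \<open>The - Ln a from the power cancels the Ln a in the derivative of the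
    remainder.\<close>
  have A_deriv: "(A has_field_derivative - Digamma a) (at 1)"
  proof -
    have "((\<lambda>s. a powr (1 - s)) has_field_derivative - Ln a) (at 1)"
      using a by (auto simp: powr_def intro!: derivative_eq_intros)
    from DERIV_add[OF this rem_series_1_deriv_at_1[OF assms]] show ?thesis
      by (simp add: A_def R_def)
  qed
  have A_holo: "A holomorphic_on {s. Re s > 0}"
    using a RS_holo(1)[of 1] unfolding A_def by (auto intro!: holomorphic_intros)

  define B where "B = (\<lambda>s. A s + (s - 1) * S 1 s)"
  have S1: "S 1 1 = 0"
    using rem_series_1_at_1[OF assms] by (simp add: S_def)
  have B_holo: "B holomorphic_on {s. Re s > 0}"
    using A_holo RS_holo(2)[of 1] unfolding B_def by (auto intro!: holomorphic_intros)
  \<comment> \<open>\<open>S 1\<close> vanishes at 1, so (s - 1) \<open>S 1\<close> has a zero of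
    order at least two there and B inherits the derivative of A.\<close>
  have B_deriv: "(B has_field_derivative - Digamma a) (at 1)"
  proof -
    have "(S 1 has_field_derivative deriv (S 1) 1) (at 1)"
      by (rule holomorphic_derivI[OF RS_holo(2)[of 1]]) (auto simp: open_halfspace_Re_gt)
    hence "((\<lambda>s. (s - 1) * S 1 s) has_field_derivative 0) (at 1)"
      using S1 by (auto intro!: derivative_eq_intros)
    from DERIV_add[OF A_deriv this] show ?thesis by (simp add: B_def)
  qed

  \<comment> \<open>Regularity of the Hurwitz zeta function at 0\<close>
  have Z_lim: "Z \<midarrow>0\<rightarrow> 1 / 2 - a"
  proof -
    have "isCont A 1" using A_deriv by (rule DERIV_isCont)
    hence "((\<lambda>s. A (s + 1)) \<longlongrightarrow> 1) (at 0)"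
      using A1 by (simp add: isCont_def LIM_offset_zero_iff add.commute)
    moreover have "(R 2 \<longlongrightarrow> 0) (at 0)"
      using analytic_at_imp_isCont[OF RS_analytic(1)] rem_series_2_at_0[OF assms]
      by (simp add: isCont_def R_def)
    moreover have "((\<lambda>s. a powr (1 - s)) \<longlongrightarrow> a powr (1 - 0)) (at 0)"
    proof -
      have "isCont (\<lambda>s. exp ((1 - s) * Ln a)) 0"
        by (intro continuous_intros)
      thus ?thesis using a by (simp add: isCont_def powr_def)
    qed
    ultimately have "((\<lambda>s. A (s + 1) / 2 - (R 2 s + a powr (1 - s)) / (1 - s)) \<longlongrightarrow>
        1 / 2 - (0 + a powr (1 - 0)) / (1 - 0)) (at 0)"
      by (intro tendsto_diff tendsto_divide tendsto_add tendsto_const tendsto_ident_at) auto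
    \<comment> \<open>The factor s in the k = 2 term cancels the pole of zeta(s + 1,a), turning the
      product into A(s + 1).\<close>
    moreover have "\<forall>\<^sub>F s in at 0. A (s + 1) / 2 - (R 2 s + a powr (1 - s)) / (1 - s) = Z s"
      using Z0 shift[OF Z1] eventually_neq_at_within[of 1 0 UNIV]
    proof eventually_elim
      case (elim s)
      have "s * Z (s + 1) = A (s + 1)"
        using elim(2) by (simp add: A_def algebra_simps add_eq_0_iff)
      hence "(1 - s) * Z s = (1 - s) * A (s + 1) / 2 - (R 2 s + a powr (1 - s))"
        using elim(1) by (auto simp: field_simps add_eq_0_iff)
      with elim(3) show ?case by (simp add: field_simps)
    qed
    ultimately have "Z \<midarrow>0\<rightarrow> 1 / 2 - (0 + a powr (1 - 0)) / (1 - 0)"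
      by (rule Lim_transform_eventually)
    thus ?thesis using a by simp
  qed
  \<comment> \<open>A finite limit excludes a pole, and a nicely meromorphic function is analytic
    away from its poles.\<close>
  hence "\<not> is_pole Z 0"
    unfolding is_pole_def using not_tendsto_and_filterlim_at_infinity[OF at_neq_bot] by blast
  hence Z_analytic: "Z analytic_on {0}"
    unfolding Z_def
    by (intro nicely_meromorphic_on_imp_analytic_at[OF nicely_meromorphic_hurwitz_zeta[OF assms]]) auto

  \<comment> \<open>Separation of the pole of zeta_H at 0\<close>
  define q where "q = (\<lambda>s. if s = 0 then deriv (\<lambda>s. B (s + 1)) 0 else B (s + 1) / s - B (0 + 1) / (s - 0))"
  have "(\<lambda>s. B (s + 1)) holomorphic_on ball 0 1"
  proof -
    have "(\<lambda>s. s + 1) ` ball 0 1 \<subseteq> {s. Re s > 0}"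
    proof safe
      fix s :: complex assume "s \<in> ball 0 1"
      thus "Re (s + 1) > 0" using abs_Re_le_cmod[of s] by simp
    qed
    from holomorphic_on_compose_gen[OF _ B_holo this] show ?thesis
      by (simp add: o_def holomorphic_intros)
  qed
  \<comment> \<open>q is the difference quotient (B(s + 1) - B(1)) / s with its removable
    singularity filled by B'(1), written in the shape of \<open>pole_theorem_open\<close>.\<close>
  hence "q holomorphic_on ball 0 1"
    unfolding q_def by (intro pole_theorem_open) auto
  hence q_analytic: "q analytic_on {0}"
    by (rule holomorphic_on_imp_analytic_at) auto
  have q0: "q 0 = - Digamma a"
  proof -
    have "((\<lambda>s. B (s + 1)) has_field_derivative - Digamma a) (at 0)"
      using B_deriv by (simp add: DERIV_shift[of B _ 0 1, symmetric])
    thus ?thesis by (simp add: q_def DERIV_imp_deriv)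
  qed

  \<comment> \<open>Near 0 one has s F(s + 1) = B(s + 1) / s = 1 / s + q(s). Inserting this into the
    order 2 recursion, dividing by 1 - s and splitting off 1 / (2 s) leaves Q.\<close>
  define Q where "Q = (\<lambda>s. q s / 2 - (S 2 s + Z s) / (1 - s))"
  have Q_analytic: "Q analytic_on {0}"
    unfolding Q_def by (intro analytic_intros q_analytic RS_analytic Z_analytic) auto
  have Q0: "Q 0 = - Z 0 - Digamma a / 2"
    using rem_series_2_at_0[OF assms] by (simp add: Q_def q0 S_def)
  have F_eq: "\<forall>\<^sub>F s in at 0. F s = 1 / (2 * s) + Q s"
    using F0 shift[OF F1] shift[OF Z1] eventually_neq_at_within[of 1 0 UNIV]
      eventually_neq_at_within[of 0 0 UNIV]
  proof eventually_elim
    case (elim s)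
    have ZA: "s * Z (s + 1) = A (s + 1)"
      using elim(3) by (simp add: A_def algebra_simps add_eq_0_iff)
    have "s * F (s + 1) = S 1 (s + 1) + Z (s + 1)"
      using elim(2) by (simp add: algebra_simps add_eq_0_iff)
    hence "s * (s * F (s + 1)) = B (s + 1)"
      using ZA by (simp add: B_def algebra_simps)
    hence FB: "s * F (s + 1) = B (s + 1) / s"
      using elim(5) by (simp add: field_simps)
    have "(1 - s) * F s = (1 - s) / 2 * (s * F (s + 1)) - (S 2 s + Z s)"
      using elim(1) by (simp add: field_simps add_eq_0_iff)
    hence "F s = ((1 - s) / 2 * (B (s + 1) / s) - (S 2 s + Z s)) / (1 - s)"
      unfolding FB using elim(4) by (simp add: nonzero_eq_divide_eq mult.commute)
    also have "\<dots> = B (s + 1) / (2 * s) - (S 2 s + Z s) / (1 - s)"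
    proof -
      have "((1 - s) / 2 * x - y) / (1 - s) = x / 2 - y / (1 - s)" for x y
        using elim(4) by (simp add: field_simps)
      from this[of "B (s + 1) / s" "S 2 s + Z s"] show ?thesis
        by (simp only: divide_divide_eq_left mult.commute[of s])
    qed
    finally have "F s = B (s + 1) / (2 * s) - (S 2 s + Z s) / (1 - s)" .
    moreover have "q s = B (s + 1) / s - 1 / s"
      using elim(5) A1 S1 by (simp add: q_def B_def)
    ultimately show ?case
      by (simp add: Q_def diff_divide_distrib)
  qed

  \<comment> \<open>Laurent series and the constant term\<close>
  have "Q has_fps_expansion fps_expansion Q 0"
    using Q_analytic by (rule analytic_at_imp_has_fps_expansion_0)
  hence Q_exp: "Q has_laurent_expansion fps_to_fls (fps_expansion Q 0)"
    by (rule has_laurent_expansion_fps)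
  have rhs_exp: "(\<lambda>s. 1 / 2 * inverse s + Q s) has_laurent_expansion
          fls_const (1 / 2) * inverse fls_X + fps_to_fls (fps_expansion Q 0)"
    by (intro laurent_expansion_intros Q_exp)
  have rhs_eq: "\<forall>\<^sub>F s in at 0. F s = 1 / 2 * inverse s + Q s"
    using F_eq by eventually_elim (simp add: field_simps)
  have "F has_laurent_expansion fls_const (1 / 2) * inverse fls_X + fps_to_fls (fps_expansion Q 0)"
    unfolding has_laurent_expansion_cong[OF rhs_eq refl] by (rule rhs_exp)
  hence "gamma_H0 0 a = fls_nth (fls_const (1 / 2) * inverse fls_X + fps_to_fls (fps_expansion Q 0)) 0"
    unfolding gamma_H0_def F_def by (simp add: laurent_expansion_0_eqI)
  \<comment> \<open>The polar part contributes only at index -1, so the coefficient at index 0 is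
    the zeroth Taylor coefficient of Q.\<close>
  also have "\<dots> = Q 0"
    by (simp add: fls_inverse_X fps_expansion_def)
  finally have gamma: "gamma_H0 0 a = Q 0" .

  have "Q field_differentiable at 0"
    using Q_analytic by (rule analytic_on_imp_differentiable_at) simp
  hence "(Q has_field_derivative deriv Q 0) (at 0)"
    by (rule field_differentiable_derivI)
  hence "((\<lambda>s. (Q s - Q 0) / s) \<longlongrightarrow> deriv Q 0) (at 0)"
    by (simp add: has_field_derivative_iff)
  hence "(\<lambda>s. Q s - Q 0) \<in> O[at 0](\<lambda>s. s)"
    by (rule bigoI_tendsto) (simp add: eventually_neq_at_within)
  also have "?this \<longleftrightarrow> (\<lambda>s. zeta_H s a - (1 / (2 * s) + gamma_H0 0 a)) \<in> O[at 0](\<lambda>s. s)"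
    using F_eq unfolding gamma F_def
    by (intro landau_o.big.in_cong) (auto elim!: eventually_mono)
  finally show ?thesis using gamma Q0 by (simp add: Z_def)
qed

end
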